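(* The class of quasi-Artinian Leibniz algebras is $Q$-closed; that is, if $\mathfrak{g}$ is a quasi-Artinian Leibniz algebra and $J$ is an ideal of $\mathfrak{g}$, then $\mathfrak{g}/J$ is quasi-Artinian.
   Context: A (left) Leibniz algebra is a vector space $\mathfrak{g}$ (of arbitrary dimension) over a field with a bilinear bracket satisfying $[x,[y,z]]=[[x,y],z]+[y,[x,z]]$ for all $x,y,z$. "Ideal" means two-sided ideal. For subspaces $A,B$, $[A,B]$ is the linear span of all $[a,b]$, $a\in A$, $b\in B$. The derived series is $\mathfrak{g}^{(0)}=\mathfrak{g}$, $\mathfrak{g}^{(n+1)}=[\mathfrak{g}^{(n)},\mathfrak{g}^{(n)}]$. $\mathfrak{g}$ is left (resp. right) quasi-Artinian if for every descending chain of ideals $I_1\supseteq I_2\supseteq\cdots$ of $\mathfrak{g}$ there is $m\in\mathbb{N}$ such that $[\mathfrak{g}^{(m)},I_m]\subseteq I_n$ (resp. $[I_m,\mathfrak{g}^{(m)}]\subseteq I_n$) for all $n\in\mathbb{N}$; it is quasi-Artinian if it is both left and right quasi-Artinian. A class of Leibniz algebras is $Q$-closed if it is closed under taking quotients by ideals. *)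

theory Defs
  imports "HOL-Algebra.Module" "HOL-Algebra.QuotRing"
begin

text \<open>
  A Leibniz algebra over \<open>K\<close> is carried by a module record \<open>L\<close> whose multiplication
  \<open>x \<otimes>\<^bsub>L\<^esub> y\<close> is the bracket \<open>[x, y]\<close>.  The bracket is in general neither associative nor
  unital, and the field \<open>\<one>\<^bsub>L\<^esub>\<close> of the record plays no role.
\<close>

locale leibniz_algebra = field K + module K L for K (structure) and L (structure) +
  assumes bracket_closed:
      "\<lbrakk>x \<in> carrier L; y \<in> carrier L\<rbrakk> \<Longrightarrow> x \<otimes>\<^bsub>L\<^esub> y \<in> carrier L"
    and bracket_add_left:
      "\<lbrakk>x \<in> carrier L; y \<in> carrier L; z \<in> carrier L\<rbrakk> \<Longrightarrow>
        (x \<oplus>\<^bsub>L\<^esub> y) \<otimes>\<^bsub>L\<^esub> z = x \<otimes>\<^bsub>L\<^esub> z \<oplus>\<^bsub>L\<^esub> y \<otimes>\<^bsub>L\<^esub> z"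
    and bracket_add_right:
      "\<lbrakk>x \<in> carrier L; y \<in> carrier L; z \<in> carrier L\<rbrakk> \<Longrightarrow>
        x \<otimes>\<^bsub>L\<^esub> (y \<oplus>\<^bsub>L\<^esub> z) = x \<otimes>\<^bsub>L\<^esub> y \<oplus>\<^bsub>L\<^esub> x \<otimes>\<^bsub>L\<^esub> z"
    and bracket_smult_left:
      "\<lbrakk>c \<in> carrier K; x \<in> carrier L; y \<in> carrier L\<rbrakk> \<Longrightarrow>
        (c \<odot>\<^bsub>L\<^esub> x) \<otimes>\<^bsub>L\<^esub> y = c \<odot>\<^bsub>L\<^esub> (x \<otimes>\<^bsub>L\<^esub> y)"
    and bracket_smult_right:
      "\<lbrakk>c \<in> carrier K; x \<in> carrier L; y \<in> carrier L\<rbrakk> \<Longrightarrow>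
        x \<otimes>\<^bsub>L\<^esub> (c \<odot>\<^bsub>L\<^esub> y) = c \<odot>\<^bsub>L\<^esub> (x \<otimes>\<^bsub>L\<^esub> y)"
    and left_leibniz:
      "\<lbrakk>x \<in> carrier L; y \<in> carrier L; z \<in> carrier L\<rbrakk> \<Longrightarrow>
        x \<otimes>\<^bsub>L\<^esub> (y \<otimes>\<^bsub>L\<^esub> z) = (x \<otimes>\<^bsub>L\<^esub> y) \<otimes>\<^bsub>L\<^esub> z \<oplus>\<^bsub>L\<^esub> y \<otimes>\<^bsub>L\<^esub> (x \<otimes>\<^bsub>L\<^esub> z)"

definition leibniz_ideal ::
  "('k, 'm) ring_scheme \<Rightarrow> ('k, 'a, 'n) module_scheme \<Rightarrow> 'a set \<Rightarrow> bool" where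
  "leibniz_ideal K L I \<longleftrightarrow>
     submodule I K L \<and>
     (\<forall>x\<in>carrier L. \<forall>a\<in>I. x \<otimes>\<^bsub>L\<^esub> a \<in> I \<and> a \<otimes>\<^bsub>L\<^esub> x \<in> I)"

definition linear_span ::
  "('k, 'm) ring_scheme \<Rightarrow> ('k, 'a, 'n) module_scheme \<Rightarrow> 'a set \<Rightarrow> 'a set" where
  "linear_span K L S = \<Inter>{V. submodule V K L \<and> S \<subseteq> V}"

definition bracket_span ::
  "('k, 'm) ring_scheme \<Rightarrow> ('k, 'a, 'n) module_scheme \<Rightarrow> 'a set \<Rightarrow> 'a set \<Rightarrow> 'a set" where
  "bracket_span K L A B = linear_span K L {a \<otimes>\<^bsub>L\<^esub> b | a b. a \<in> A \<and> b \<in> B}"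

primrec derived_series ::
  "('k, 'm) ring_scheme \<Rightarrow> ('k, 'a, 'n) module_scheme \<Rightarrow> nat \<Rightarrow> 'a set" where
  "derived_series K L 0 = carrier L"
| "derived_series K L (Suc n) =
     bracket_span K L (derived_series K L n) (derived_series K L n)"

text \<open>Chains are indexed from \<open>1\<close>; the value \<open>I 0\<close> is unconstrained and never used.\<close>

definition descending_ideal_chain ::
  "('k, 'm) ring_scheme \<Rightarrow> ('k, 'a, 'n) module_scheme \<Rightarrow> (nat \<Rightarrow> 'a set) \<Rightarrow> bool" where
  "descending_ideal_chain K L I \<longleftrightarrow>
     (\<forall>n\<ge>1. leibniz_ideal K L (I n)) \<and> (\<forall>n\<ge>1. I (Suc n) \<subseteq> I n)"

definition left_quasi_Artinian ::
  "('k, 'm) ring_scheme \<Rightarrow> ('k, 'a, 'n) module_scheme \<Rightarrow> bool" where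
  "left_quasi_Artinian K L \<longleftrightarrow>
     (\<forall>I. descending_ideal_chain K L I \<longrightarrow>
        (\<exists>m\<ge>1. \<forall>n\<ge>1. bracket_span K L (derived_series K L m) (I m) \<subseteq> I n))"

definition right_quasi_Artinian ::
  "('k, 'm) ring_scheme \<Rightarrow> ('k, 'a, 'n) module_scheme \<Rightarrow> bool" where
  "right_quasi_Artinian K L \<longleftrightarrow>
     (\<forall>I. descending_ideal_chain K L I \<longrightarrow>
        (\<exists>m\<ge>1. \<forall>n\<ge>1. bracket_span K L (I m) (derived_series K L m) \<subseteq> I n))"

definition quasi_Artinian ::
  "('k, 'm) ring_scheme \<Rightarrow> ('k, 'a, 'n) module_scheme \<Rightarrow> bool" where
  "quasi_Artinian K L \<longleftrightarrow> left_quasi_Artinian K L \<and> right_quasi_Artinian K L"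

text \<open>
  The quotient consists of the additive cosets of \<open>J\<close>.  The ring fields are those of
  \<^const>\<open>FactRing\<close>; the scalar multiple \<open>c \<odot> A\<close> is the coset of \<open>c \<odot>\<^bsub>L\<^esub> x\<close> for any
  representative \<open>x \<in> A\<close>, written as a union over all representatives in the same way as
  \<^const>\<open>rcoset_mult\<close>.
\<close>

definition leibniz_quotient ::
  "('k, 'a, 'n) module_scheme \<Rightarrow> 'a set \<Rightarrow> ('k, 'a set) module" where
  "leibniz_quotient L J =
     \<lparr>carrier = a_rcosets\<^bsub>L\<^esub> J,
      mult = rcoset_mult L J,
      one = J +>\<^bsub>L\<^esub> \<one>\<^bsub>L\<^esub>,
      zero = J,
      add = set_add L,
      smult = (\<lambda>c A. \<Union>x\<in>A. J +>\<^bsub>L\<^esub> (c \<odot>\<^bsub>L\<^esub> x))\<rparr>"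

end

theory Submission
  imports Defs
begin

text \<open>
  The preimages under the canonical projection \<open>f\<close> of a descending chain \<open>I\<close> of ideals of the
  quotient form a descending chain of ideals of \<open>L\<close>.  Since \<open>f\<close> is surjective, the terms of the
  derived series of the quotient lie in the images of those of \<open>L\<close>, and \<open>I m\<close> is the image of its
  preimage; so the index \<open>m\<close> found in \<open>L\<close> also works in the quotient.
\<close>

section \<open>Spans of brackets\<close>

lemma linear_span_minimal:
  assumes "submodule V K L" and "S \<subseteq> V"
  shows "linear_span K L S \<subseteq> V"
  using assms unfolding linear_span_def by blast

lemma bracket_span_minimal:
  assumes "submodule V K L"
    and "\<And>a b. \<lbrakk>a \<in> A; b \<in> B\<rbrakk> \<Longrightarrow> a \<otimes>\<^bsub>L\<^esub> b \<in> V"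
  shows "bracket_span K L A B \<subseteq> V"
  unfolding bracket_span_def using assms by (intro linear_span_minimal) auto

lemma bracket_in_bracket_span:
  assumes "a \<in> A" and "b \<in> B"
  shows "a \<otimes>\<^bsub>L\<^esub> b \<in> bracket_span K L A B"
  using assms unfolding bracket_span_def linear_span_def by blast

lemma (in module) submodule_zero_closed: "submodule H R M \<Longrightarrow> \<zero>\<^bsub>M\<^esub> \<in> H"
  using subgroup.one_closed[OF submodule.axioms(1)] by fastforce

text \<open>The hypothesis makes \<open>carrier M\<close> one of the submodules being intersected;
  over an empty family the intersection would be the whole type. All other closure properties pass
  to intersections.\<close>

lemma (in module) linear_span_submodule:
  assumes "S \<subseteq> carrier M"
  shows "submodule (linear_span R M S) R M"
proof (rule submoduleI)
  show "linear_span R M S \<subseteq> carrier M"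
    by (rule linear_span_minimal[OF carrier_is_submodule assms])
  show "\<zero>\<^bsub>M\<^esub> \<in> linear_span R M S"
    by (simp add: linear_span_def submodule_zero_closed)
qed (auto simp: linear_span_def submoduleE)

context leibniz_algebra
begin

lemma bracket_span_submodule:
  assumes "A \<subseteq> carrier L" and "B \<subseteq> carrier L"
  shows "submodule (bracket_span K L A B) K L"
  unfolding bracket_span_def
  using assms by (intro linear_span_submodule) (auto intro: bracket_closed)

lemma derived_series_submodule: "submodule (derived_series K L n) K L"
proof (induction n)
  case 0
  show ?case by (simp add: carrier_is_submodule)
next
  case (Suc n)
  then show ?case by (simp add: bracket_span_submodule submoduleE(1))
qed

lemma derived_series_subset: "derived_series K L n \<subseteq> carrier L"
  by (rule submoduleE(1)[OF derived_series_submodule])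

end

section \<open>Surjective homomorphisms\<close>

text \<open>Transferring the chain condition uses only a surjective linear map that respects
  brackets, so the argument is carried out for an arbitrary one, and cosets enter only
  later.\<close>

locale leibniz_epimorphism =
  L: leibniz_algebra K L + Q: leibniz_algebra K Q
  for K (structure) and L (structure) and Q (structure) +
  fixes f
  assumes image_carrier: "f ` carrier L = carrier Q"
    and map_add: "\<lbrakk>x \<in> carrier L; y \<in> carrier L\<rbrakk> \<Longrightarrow> f (x \<oplus>\<^bsub>L\<^esub> y) = f x \<oplus>\<^bsub>Q\<^esub> f y"
    and map_smult: "\<lbrakk>c \<in> carrier K; x \<in> carrier L\<rbrakk> \<Longrightarrow> f (c \<odot>\<^bsub>L\<^esub> x) = c \<odot>\<^bsub>Q\<^esub> f x"
    and map_bracket: "\<lbrakk>x \<in> carrier L; y \<in> carrier L\<rbrakk> \<Longrightarrow> f (x \<otimes>\<^bsub>L\<^esub> y) = f x \<otimes>\<^bsub>Q\<^esub> f y"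
begin

lemma map_closed: "x \<in> carrier L \<Longrightarrow> f x \<in> carrier Q"
  using image_carrier by blast

text \<open>Additivity between groups already forces zero and negatives to be preserved; this makes
  those facts available.\<close>

sublocale abelian_group_hom L Q f
proof (intro abelian_group_homI group_hom.intro group_hom_axioms.intro)
  show "f \<in> hom (add_monoid L) (add_monoid Q)"
    by (auto simp: hom_def map_closed map_add)
qed (rule L.abelian_group_axioms Q.abelian_group_axioms L.a_group Q.a_group)+

text \<open>Allows the minimality of spans to be applied in \<open>Q\<close> to images of terms of
  the derived series of \<open>L\<close>.\<close>

lemma image_submodule:
  assumes "submodule V K L"
  shows "submodule (f ` V) K Q"
proof -
  note V = L.submoduleE[OF assms]
  have closed: "x \<in> carrier L" if "x \<in> V" for x
    using V(1) that by blast
  show ?thesis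
  proof (rule Q.submoduleI)
    show "f ` V \<subseteq> carrier Q" using closed map_closed by blast
    have "\<zero>\<^bsub>L\<^esub> \<in> V" by (rule L.submodule_zero_closed[OF assms])
    then show "\<zero>\<^bsub>Q\<^esub> \<in> f ` V" by (metis hom_zero imageI)
    show "\<ominus>\<^bsub>Q\<^esub> y \<in> f ` V" if y: "y \<in> f ` V" for y
    proof -
      obtain u where "u \<in> V" "y = f u" using y by blast
      then show ?thesis using hom_a_inv[OF closed] V(3) by (metis imageI)
    qed
    show "y \<oplus>\<^bsub>Q\<^esub> z \<in> f ` V" if y: "y \<in> f ` V" and z: "z \<in> f ` V" for y z
    proof -
      obtain u v where "u \<in> V" "y = f u" "v \<in> V" "z = f v" using y z by blast
      then show ?thesis using map_add[OF closed closed] V(5) by (metis imageI)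
    qed
    show "c \<odot>\<^bsub>Q\<^esub> y \<in> f ` V" if c: "c \<in> carrier K" and y: "y \<in> f ` V" for c y
    proof -
      obtain u where "u \<in> V" "y = f u" using y by blast
      then show ?thesis using map_smult[OF c closed] V(4)[OF c] by (metis imageI)
    qed
  qed
qed

lemma vimage_ideal:
  assumes "leibniz_ideal K Q I"
  shows "leibniz_ideal K L {x \<in> carrier L. f x \<in> I}"
proof -
  have I: "submodule I K Q" using assms by (simp add: leibniz_ideal_def)
  have "submodule {x \<in> carrier L. f x \<in> I} K L"
  proof (rule L.submoduleI)
    have "\<zero>\<^bsub>Q\<^esub> \<in> I" by (rule Q.submodule_zero_closed[OF I])
    then show "\<zero>\<^bsub>L\<^esub> \<in> {x \<in> carrier L. f x \<in> I}" by simp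
  qed (auto simp: map_add map_smult Q.submoduleE[OF I])
  then show ?thesis
    using assms by (auto simp: leibniz_ideal_def map_bracket map_closed L.bracket_closed)
qed

text \<open>By induction, both factors of a generating bracket lift to \<open>L\<close>. The bracket
  of the lifts lies in the next term there, and the image of that term is a submodule, hence
  contains the whole span.\<close>

lemma derived_series_subset_image: "derived_series K Q n \<subseteq> f ` derived_series K L n"
proof (induction n)
  case 0
  show ?case by (simp add: image_carrier)
next
  case (Suc n)
  let ?D = "derived_series K L"
  have "bracket_span K Q (derived_series K Q n) (derived_series K Q n) \<subseteq> f ` ?D (Suc n)"
  proof (rule bracket_span_minimal)
    show "submodule (f ` ?D (Suc n)) K Q"
      by (rule image_submodule[OF L.derived_series_submodule])
    fix a b assume "a \<in> derived_series K Q n" "b \<in> derived_series K Q n"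
    then obtain x y where x: "x \<in> ?D n" "a = f x" and y: "y \<in> ?D n" "b = f y"
      using Suc by blast
    then have "a \<otimes>\<^bsub>Q\<^esub> b = f (x \<otimes>\<^bsub>L\<^esub> y)"
      by (simp add: map_bracket subsetD[OF L.derived_series_subset])
    then show "a \<otimes>\<^bsub>Q\<^esub> b \<in> f ` ?D (Suc n)"
      using x y by (simp add: bracket_in_bracket_span)
  qed
  then show ?case by simp
qed

text \<open>Generating brackets lift to \<open>L\<close>, where the last assumption applies. With
  both factors arbitrary, the left and the right condition are instances of this one
  argument.\<close>

lemma bracket_span_subset:
  assumes "submodule V K Q"
    and "A' \<subseteq> f ` A" and "B' \<subseteq> f ` B"
    and "A \<subseteq> carrier L" and "B \<subseteq> carrier L"
    and "bracket_span K L A B \<subseteq> {x \<in> carrier L. f x \<in> V}"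
  shows "bracket_span K Q A' B' \<subseteq> V"
proof (rule bracket_span_minimal[OF assms(1)])
  fix a b assume "a \<in> A'" "b \<in> B'"
  then obtain x y where x: "x \<in> A" "a = f x" and y: "y \<in> B" "b = f y"
    using assms(2,3) by blast
  then have "f (x \<otimes>\<^bsub>L\<^esub> y) \<in> V"
    using subsetD[OF assms(6) bracket_in_bracket_span] by simp
  then show "a \<otimes>\<^bsub>Q\<^esub> b \<in> V"
    using x y by (simp add: map_bracket subsetD[OF assms(4)] subsetD[OF assms(5)])
qed

context
  fixes I
  assumes chain: "descending_ideal_chain K Q I"
begin

lemma vimage_chain: "descending_ideal_chain K L (\<lambda>n. {x \<in> carrier L. f x \<in> I n})"
  using chain by (auto simp: descending_ideal_chain_def vimage_ideal)

lemma chain_submodule: "n \<ge> 1 \<Longrightarrow> submodule (I n) K Q"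
  using chain by (simp add: descending_ideal_chain_def leibniz_ideal_def)

text \<open>This is where surjectivity acts on the chain: every element of an ideal of
  \<open>Q\<close> has a preimage in \<open>L\<close>.\<close>

lemma chain_subset_image: "n \<ge> 1 \<Longrightarrow> I n \<subseteq> f ` {x \<in> carrier L. f x \<in> I n}"
  using Q.submoduleE(1)[OF chain_submodule, of n] by (auto simp flip: image_carrier)

end

lemma left_quasi_Artinian_image:
  assumes "left_quasi_Artinian K L"
  shows "left_quasi_Artinian K Q"
  unfolding left_quasi_Artinian_def
proof (intro allI impI)
  fix I assume chain: "descending_ideal_chain K Q I"
  \<comment> \<open>The hypothesis on \<open>L\<close> is applied to the chain of preimages. The
    bound on \<open>m\<close> matters: it makes \<open>I m\<close> an ideal of \<open>Q\<close>, and
    so the image of its preimage.\<close>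
  obtain m where "m \<ge> 1" and m: "\<And>n. n \<ge> 1 \<Longrightarrow>
      bracket_span K L (derived_series K L m) {x \<in> carrier L. f x \<in> I m}
        \<subseteq> {x \<in> carrier L. f x \<in> I n}"
    using assms vimage_chain[OF chain] unfolding left_quasi_Artinian_def by blast
  have "bracket_span K Q (derived_series K Q m) (I m) \<subseteq> I n" if "n \<ge> 1" for n
    by (rule bracket_span_subset[OF chain_submodule[OF chain that] derived_series_subset_image
          chain_subset_image[OF chain \<open>m \<ge> 1\<close>] L.derived_series_subset _ m[OF that]]) blast
  with \<open>m \<ge> 1\<close> show "\<exists>m\<ge>1. \<forall>n\<ge>1. bracket_span K Q (derived_series K Q m) (I m) \<subseteq> I n"
    by blast
qed

lemma right_quasi_Artinian_image:
  assumes "right_quasi_Artinian K L"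
  shows "right_quasi_Artinian K Q"
  unfolding right_quasi_Artinian_def
proof (intro allI impI)
  fix I assume chain: "descending_ideal_chain K Q I"
  obtain m where "m \<ge> 1" and m: "\<And>n. n \<ge> 1 \<Longrightarrow>
      bracket_span K L {x \<in> carrier L. f x \<in> I m} (derived_series K L m)
        \<subseteq> {x \<in> carrier L. f x \<in> I n}"
    using assms vimage_chain[OF chain] unfolding right_quasi_Artinian_def by blast
  have "bracket_span K Q (I m) (derived_series K Q m) \<subseteq> I n" if "n \<ge> 1" for n
    by (rule bracket_span_subset[OF chain_submodule[OF chain that]
          chain_subset_image[OF chain \<open>m \<ge> 1\<close>] derived_series_subset_image
          _ L.derived_series_subset m[OF that]]) blast
  with \<open>m \<ge> 1\<close> show "\<exists>m\<ge>1. \<forall>n\<ge>1. bracket_span K Q (I m) (derived_series K Q m) \<subseteq> I n"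
    by blast
qed

lemma quasi_Artinian_image: "quasi_Artinian K L \<Longrightarrow> quasi_Artinian K Q"
  by (simp add: quasi_Artinian_def left_quasi_Artinian_image right_quasi_Artinian_image)

end

section \<open>The quotient by an ideal\<close>

locale leibniz_algebra_ideal = leibniz_algebra K L
  for K (structure) and L (structure) +
  fixes J
  assumes ideal: "leibniz_ideal K L J"
begin

lemma ideal_submodule: "submodule J K L"
  using ideal by (simp add: leibniz_ideal_def)

lemma ideal_subset: "J \<subseteq> carrier L"
  by (rule submoduleE(1)[OF ideal_submodule])

sublocale J: abelian_subgroup J L
  by (intro abelian_subgroupI3 additive_subgroupI abelian_group_axioms
      submodule.axioms(1)[OF ideal_submodule])

lemma coset_repr:
  assumes "x \<in> carrier L" and "y \<in> J +>\<^bsub>L\<^esub> x"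
  obtains j where "j \<in> J" and "y = j \<oplus>\<^bsub>L\<^esub> x"
  using assms by (auto simp: a_r_coset_def')

lemma coset_absorb:
  assumes "j \<in> J" and "x \<in> carrier L"
  shows "J +>\<^bsub>L\<^esub> (j \<oplus>\<^bsub>L\<^esub> x) = J +>\<^bsub>L\<^esub> x"
  using assms a_repr_independence[OF _ _ J.a_subgroup] a_rcosI[OF _ ideal_subset] by metis

text \<open>Another representative changes the scalar multiple by some \<open>c \<odot> j\<close> in
  \<open>J\<close>, so all members of the union coincide; the union is nonempty because
  \<open>x\<close> lies in its own coset.\<close>

lemma coset_smult:
  assumes c: "c \<in> carrier K" and x: "x \<in> carrier L"
  shows "(\<Union>y\<in>J +>\<^bsub>L\<^esub> x. J +>\<^bsub>L\<^esub> (c \<odot>\<^bsub>L\<^esub> y)) = J +>\<^bsub>L\<^esub> (c \<odot>\<^bsub>L\<^esub> x)"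
proof -
  have "J +>\<^bsub>L\<^esub> (c \<odot>\<^bsub>L\<^esub> y) = J +>\<^bsub>L\<^esub> (c \<odot>\<^bsub>L\<^esub> x)" if "y \<in> J +>\<^bsub>L\<^esub> x" for y
  proof -
    obtain j where j: "j \<in> J" "y = j \<oplus>\<^bsub>L\<^esub> x" using coset_repr[OF x \<open>y \<in> _\<close>] .
    then show ?thesis
      using c x ideal_subset by (auto simp: smult_r_distr coset_absorb submoduleE(4)[OF ideal_submodule])
  qed
  then show ?thesis using J.a_rcos_self[OF x] by blast
qed

text \<open>Two-sidedness of \<open>J\<close> is essential here: changing the left representative
  adds a bracket with left factor in \<open>J\<close>, changing the right one adds a bracket with
  right factor in \<open>J\<close>.\<close>

lemma coset_bracket:
  assumes x: "x \<in> carrier L" and y: "y \<in> carrier L"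
  shows "rcoset_mult L J (J +>\<^bsub>L\<^esub> x) (J +>\<^bsub>L\<^esub> y) = J +>\<^bsub>L\<^esub> (x \<otimes>\<^bsub>L\<^esub> y)"
proof -
  have "J +>\<^bsub>L\<^esub> (u \<otimes>\<^bsub>L\<^esub> v) = J +>\<^bsub>L\<^esub> (x \<otimes>\<^bsub>L\<^esub> y)"
    if u: "u \<in> J +>\<^bsub>L\<^esub> x" and v: "v \<in> J +>\<^bsub>L\<^esub> y" for u v
  proof -
    obtain i where i: "i \<in> J" "u = i \<oplus>\<^bsub>L\<^esub> x" using coset_repr[OF x u] .
    obtain j where j: "j \<in> J" "v = j \<oplus>\<^bsub>L\<^esub> y" using coset_repr[OF y v] .
    have carr: "i \<in> carrier L" "j \<in> carrier L" using i j ideal_subset by auto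
    have v': "v \<in> carrier L" using j carr y by simp
    \<comment> \<open>Keeping \<open>v\<close> whole in the first summand leaves only two error
      terms, nested so that \<open>coset_absorb\<close> removes them one after the other.\<close>
    have "u \<otimes>\<^bsub>L\<^esub> v = i \<otimes>\<^bsub>L\<^esub> v \<oplus>\<^bsub>L\<^esub> (x \<otimes>\<^bsub>L\<^esub> j \<oplus>\<^bsub>L\<^esub> x \<otimes>\<^bsub>L\<^esub> y)"
      using carr x y v' by (simp add: i(2) bracket_add_left) (simp add: j(2) bracket_add_right)
    moreover have "i \<otimes>\<^bsub>L\<^esub> v \<in> J" "x \<otimes>\<^bsub>L\<^esub> j \<in> J"
      using ideal i j v' x by (auto simp: leibniz_ideal_def)
    ultimately show ?thesis
      using carr x y by (simp add: coset_absorb bracket_closed)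
  qed
  then show ?thesis
    unfolding rcoset_mult_def using J.a_rcos_self[OF x] J.a_rcos_self[OF y] by blast
qed

abbreviation quotient (\<open>Q\<close>) where "Q \<equiv> leibniz_quotient L J"

lemma quotient_carrier: "carrier Q = (\<lambda>x. J +>\<^bsub>L\<^esub> x) ` carrier L"
  by (auto simp: leibniz_quotient_def A_RCOSETS_def')

lemma quotient_add:
  "\<lbrakk>x \<in> carrier L; y \<in> carrier L\<rbrakk> \<Longrightarrow>
    (J +>\<^bsub>L\<^esub> x) \<oplus>\<^bsub>Q\<^esub> (J +>\<^bsub>L\<^esub> y) = J +>\<^bsub>L\<^esub> (x \<oplus>\<^bsub>L\<^esub> y)"
  by (simp add: leibniz_quotient_def J.a_rcos_sum)

lemma quotient_smult:
  "\<lbrakk>c \<in> carrier K; x \<in> carrier L\<rbrakk> \<Longrightarrow> c \<odot>\<^bsub>Q\<^esub> (J +>\<^bsub>L\<^esub> x) = J +>\<^bsub>L\<^esub> (c \<odot>\<^bsub>L\<^esub> x)"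
  by (simp add: leibniz_quotient_def coset_smult)

lemma quotient_bracket:
  "\<lbrakk>x \<in> carrier L; y \<in> carrier L\<rbrakk> \<Longrightarrow>
    (J +>\<^bsub>L\<^esub> x) \<otimes>\<^bsub>Q\<^esub> (J +>\<^bsub>L\<^esub> y) = J +>\<^bsub>L\<^esub> (x \<otimes>\<^bsub>L\<^esub> y)"
  by (simp add: leibniz_quotient_def coset_bracket)

text \<open>Presents the zero, which the record gives as \<open>J\<close>, as a coset with a
  representative, so that the rules computing on representatives apply to it too.\<close>

lemma quotient_zero: "\<zero>\<^bsub>Q\<^esub> = J +>\<^bsub>L\<^esub> \<zero>\<^bsub>L\<^esub>"
  by (simp add: leibniz_quotient_def ideal_subset)

lemma quotient_abelian_group: "abelian_group Q"
proof (rule abelian_groupI)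
  show "\<exists>y\<in>carrier Q. y \<oplus>\<^bsub>Q\<^esub> x = \<zero>\<^bsub>Q\<^esub>" if "x \<in> carrier Q" for x
  proof -
    obtain u where u: "u \<in> carrier L" "x = J +>\<^bsub>L\<^esub> u"
      using \<open>x \<in> carrier Q\<close> by (auto simp: quotient_carrier)
    then have "(J +>\<^bsub>L\<^esub> (\<ominus>\<^bsub>L\<^esub> u)) \<oplus>\<^bsub>Q\<^esub> x = \<zero>\<^bsub>Q\<^esub>"
      by (simp add: quotient_add quotient_zero M.l_neg)
    then show ?thesis using u by (auto simp: quotient_carrier)
  qed
qed (auto simp: quotient_carrier quotient_add quotient_zero M.a_ac)

text \<open>\<open>bracket_closed\<close> discharges the membership conditions that arise when
  brackets occur inside other operations.\<close>

lemmas quotient_simps = quotient_add quotient_smult quotient_bracket bracket_closed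

lemma quotient_leibniz_algebra: "leibniz_algebra K Q"
proof -
  have "module K Q"
    by (rule moduleI[OF is_cring quotient_abelian_group])
      (auto simp: quotient_carrier quotient_simps smult_l_distr smult_r_distr smult_assoc1)
  \<comment> \<open>On representatives each axiom reduces to the one in \<open>L\<close>. The
    Leibniz identity is used from right to left, since its right side contains
    \<open>y \<otimes> (x \<otimes> z)\<close>, again an instance of its left side, and rewriting
    forwards could loop.\<close>
  moreover have "leibniz_algebra_axioms K Q"
    by (rule leibniz_algebra_axioms.intro)
      (auto simp: quotient_carrier quotient_simps bracket_add_left bracket_add_right
        bracket_smult_left bracket_smult_right simp flip: left_leibniz)
  ultimately show ?thesis
    by (intro leibniz_algebra.intro field_axioms)
qed

lemma projection_epimorphism: "leibniz_epimorphism K L Q (\<lambda>x. J +>\<^bsub>L\<^esub> x)"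
  by (intro leibniz_epimorphism.intro leibniz_epimorphism_axioms.intro
      leibniz_algebra_axioms quotient_leibniz_algebra)
    (simp_all add: quotient_carrier quotient_simps)

end

theorem proposition3p8:
  fixes K :: "('k, 'm) ring_scheme" and L :: "('k, 'a, 'n) module_scheme" and J :: "'a set"
  assumes "leibniz_algebra K L"
    and "quasi_Artinian K L"
    and "leibniz_ideal K L J"
  shows "leibniz_algebra K (leibniz_quotient L J) \<and> quasi_Artinian K (leibniz_quotient L J)"
proof -
  interpret leibniz_algebra_ideal K L J
    using assms(1,3) by (intro leibniz_algebra_ideal.intro leibniz_algebra_ideal_axioms.intro)
  show ?thesis
    using quotient_leibniz_algebra
      leibniz_epimorphism.quasi_Artinian_image[OF projection_epimorphism assms(2)] by blast
qed

end
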